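(* Let $\{c_n\}_{n\geq0}$ be an orthonormal basis of $L^2(\mathbb{R})$, and let $\rho_f,\rho_g:\mathbb{R}\to\mathbb{C}$ be Lebesgue-measurable functions, nonzero almost everywhere, with $\rho_f=\overline{\rho_g}^{\,-1}$ a.e. Let $\{\alpha_n\}_{n\geq0}$ be a strictly increasing sequence of real numbers with $\alpha_0=0$, and let $\overline\alpha=\sup_n\alpha_n\in(0,\infty]$. Let $\mathcal V$, its topology $\tau_{\mathcal V}$, its set of continuous linear functionals $\mathcal V'$, and the linear functionals $F(z),G(z):\mathcal V\to\mathbb{C}$ be as defined in the context. Then, for every $z\in\mathbb{C}$ with $|z|<\overline\alpha$, both $F(z)$ and $G(z)$ belong to $\mathcal V'$.
   Context: For measurable $h_1,h_2$ with $\overline{h_1}h_2\in L^1(\mathbb{R})$ write $\langle h_1,h_2\rangle=\int_{\mathbb{R}}\overline{h_1(x)}\,h_2(x)\,dx$; $\|\cdot\|$ is the $L^2(\mathbb{R})$ norm. Put $f_n=c_n\rho_f$ and $g_n=c_n\rho_g$ for $n\geq0$ (these need not be in $L^2(\mathbb{R})$), and $$\mathcal V=\{v\in L^2(\mathbb{R}):\ v\rho_f\in L^2(\mathbb{R})\ \text{and}\ v\rho_g\in L^2(\mathbb{R})\}.$$ A sequence $\{v_k\}$ in $\mathcal V$ is $\tau_{\mathcal V}$-convergent to $v$ if $v_k\to v$, $\rho_f v_k\to\rho_f v$ and $\rho_g v_k\to\rho_g v$, all in the norm of $L^2(\mathbb{R})$ (then $v\in\mathcal V$). $\mathcal V'$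 is the set of linear functionals $\Lambda:\mathcal V\to\mathbb{C}$ that are continuous, i.e. $\Lambda[v_k]\to\Lambda[v]$ whenever $v_k$ is $\tau_{\mathcal V}$-convergent to $v$. Put $\alpha_0!=1$, $\alpha_n!=\alpha_1\alpha_2\cdots\alpha_n$ for $n\geq1$, and for $|z|<\overline\alpha$ let $N(|z|)=\Big(\sum_{n\geq0}\frac{|z|^{2n}}{(\alpha_n!)^2}\Big)^{-1/2}$. For $|z|<\overline\alpha$ and $v\in\mathcal V$ the following series converge, and define $$F(z)[v]=N(|z|)\sum_{n\geq0}\frac{\overline z^{\,n}}{\alpha_n!}\langle f_n,v\rangle,\qquad G(z)[v]=N(|z|)\sum_{n\geq0}\frac{\overline z^{\,n}}{\alpha_n!}\langle g_n,v\rangle.$$ *)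

theory Defs
  imports "HOL-Analysis.Analysis"
begin

text \<open>
  Elements of \<open>L\<^sup>2(\<real>)\<close> are represented by functions rather than by classes modulo equality
  almost everywhere. Equality in the space is therefore equality a.e.; see \<open>dualV_AE_cong\<close>
  below for why nothing is lost in the description of the continuous functionals.
\<close>

definition L2 :: "(real \<Rightarrow> complex) set" where
  "L2 = {h \<in> borel_measurable lebesgue. integrable lebesgue (\<lambda>x. (cmod (h x))\<^sup>2)}"

definition L2_inner :: "(real \<Rightarrow> complex) \<Rightarrow> (real \<Rightarrow> complex) \<Rightarrow> complex" where
  "L2_inner h1 h2 = (LINT x|lebesgue. cnj (h1 x) * h2 x)"

definition L2_norm :: "(real \<Rightarrow> complex) \<Rightarrow> real" where
  "L2_norm h = sqrt (LINT x|lebesgue. (cmod (h x))\<^sup>2)"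

text \<open>
  Membership in \<open>L2\<close> is part of norm convergence: the integral in \<open>L2_norm\<close> is zero by
  convention when the integrand is not integrable.
\<close>

definition L2_tendsto :: "(nat \<Rightarrow> real \<Rightarrow> complex) \<Rightarrow> (real \<Rightarrow> complex) \<Rightarrow> bool" where
  "L2_tendsto u v \<longleftrightarrow>
     (\<forall>k. u k \<in> L2) \<and> v \<in> L2 \<and> (\<lambda>k. L2_norm (\<lambda>x. u k x - v x)) \<longlonglongrightarrow> 0"

definition L2_orthonormal_basis :: "(nat \<Rightarrow> real \<Rightarrow> complex) \<Rightarrow> bool" where
  "L2_orthonormal_basis c \<longleftrightarrow>
     (\<forall>n. c n \<in> L2) \<and>
     (\<forall>m n. L2_inner (c m) (c n) = (if m = n then 1 else 0)) \<and>
     (\<forall>h\<in>L2. L2_tendsto (\<lambda>N x. \<Sum>n<N. L2_inner (c n) h * c n x) h)"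

definition spaceV :: "(real \<Rightarrow> complex) \<Rightarrow> (real \<Rightarrow> complex) \<Rightarrow> (real \<Rightarrow> complex) set" where
  "spaceV \<rho>f \<rho>g = {v \<in> L2. (\<lambda>x. v x * \<rho>f x) \<in> L2 \<and> (\<lambda>x. v x * \<rho>g x) \<in> L2}"

definition tauV_tendsto ::
  "(real \<Rightarrow> complex) \<Rightarrow> (real \<Rightarrow> complex) \<Rightarrow> (nat \<Rightarrow> real \<Rightarrow> complex) \<Rightarrow> (real \<Rightarrow> complex) \<Rightarrow> bool" where
  "tauV_tendsto \<rho>f \<rho>g u v \<longleftrightarrow>
     (\<forall>k. u k \<in> spaceV \<rho>f \<rho>g) \<and>
     L2_tendsto u v \<and>
     L2_tendsto (\<lambda>k x. \<rho>f x * u k x) (\<lambda>x. \<rho>f x * v x) \<and>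
     L2_tendsto (\<lambda>k x. \<rho>g x * u k x) (\<lambda>x. \<rho>g x * v x)"

text \<open>Functionals are total functions here; only their values on \<open>spaceV \<rho>f \<rho>g\<close> matter.\<close>

definition linear_on_V ::
  "(real \<Rightarrow> complex) \<Rightarrow> (real \<Rightarrow> complex) \<Rightarrow> ((real \<Rightarrow> complex) \<Rightarrow> complex) \<Rightarrow> bool" where
  "linear_on_V \<rho>f \<rho>g \<Lambda> \<longleftrightarrow>
     (\<forall>u\<in>spaceV \<rho>f \<rho>g. \<forall>v\<in>spaceV \<rho>f \<rho>g. \<forall>a b.
        \<Lambda> (\<lambda>x. a * u x + b * v x) = a * \<Lambda> u + b * \<Lambda> v)"

definition dualV ::
  "(real \<Rightarrow> complex) \<Rightarrow> (real \<Rightarrow> complex) \<Rightarrow> ((real \<Rightarrow> complex) \<Rightarrow> complex) set" where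
  "dualV \<rho>f \<rho>g =
     {\<Lambda>. linear_on_V \<rho>f \<rho>g \<Lambda> \<and>
          (\<forall>u v. tauV_tendsto \<rho>f \<rho>g u v \<longrightarrow> (\<lambda>k. \<Lambda> (u k)) \<longlonglongrightarrow> \<Lambda> v)}"

definition gen_fact :: "(nat \<Rightarrow> real) \<Rightarrow> nat \<Rightarrow> real" where
  "gen_fact \<alpha> n = (\<Prod>k=1..n. \<alpha> k)"

definition coh_norm :: "(nat \<Rightarrow> real) \<Rightarrow> real \<Rightarrow> real" where
  "coh_norm \<alpha> r = (\<Sum>n. r ^ (2 * n) / (gen_fact \<alpha> n)\<^sup>2) powr (- 1 / 2)"

definition coh_functional ::
  "(nat \<Rightarrow> real) \<Rightarrow> (nat \<Rightarrow> real \<Rightarrow> complex) \<Rightarrow> complex \<Rightarrow> (real \<Rightarrow> complex) \<Rightarrow> complex" where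
  "coh_functional \<alpha> h z v =
     complex_of_real (coh_norm \<alpha> (cmod z)) *
     (\<Sum>n. cnj z ^ n / complex_of_real (gen_fact \<alpha> n) * L2_inner (h n) v)"

definition coh_F ::
  "(nat \<Rightarrow> real) \<Rightarrow> (nat \<Rightarrow> real \<Rightarrow> complex) \<Rightarrow> (real \<Rightarrow> complex) \<Rightarrow> complex
    \<Rightarrow> (real \<Rightarrow> complex) \<Rightarrow> complex" where
  "coh_F \<alpha> c \<rho>f = coh_functional \<alpha> (\<lambda>n x. c n x * \<rho>f x)"

definition coh_G ::
  "(nat \<Rightarrow> real) \<Rightarrow> (nat \<Rightarrow> real \<Rightarrow> complex) \<Rightarrow> (real \<Rightarrow> complex) \<Rightarrow> complex
    \<Rightarrow> (real \<Rightarrow> complex) \<Rightarrow> complex" where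
  "coh_G \<alpha> c \<rho>g = coh_functional \<alpha> (\<lambda>n x. c n x * \<rho>g x)"

lemma L2_mult_integrable:
  assumes "h1 \<in> L2" "h2 \<in> L2"
  shows "integrable lebesgue (\<lambda>x. cnj (h1 x) * h2 x)"
    and "cmod (L2_inner h1 h2) \<le>
      ((LINT x|lebesgue. (cmod (h1 x))\<^sup>2) + (LINT x|lebesgue. (cmod (h2 x))\<^sup>2)) / 2"
proof -
  have m[measurable]: "h1 \<in> borel_measurable lebesgue" "h2 \<in> borel_measurable lebesgue"
    and i: "integrable lebesgue (\<lambda>x. (cmod (h1 x))\<^sup>2)" "integrable lebesgue (\<lambda>x. (cmod (h2 x))\<^sup>2)"
    using assms by (auto simp: L2_def)
  have i2: "integrable lebesgue (\<lambda>x. ((cmod (h1 x))\<^sup>2 + (cmod (h2 x))\<^sup>2) / 2)"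
    using i by auto
  have le: "cmod (cnj (h1 x) * h2 x) \<le> ((cmod (h1 x))\<^sup>2 + (cmod (h2 x))\<^sup>2) / 2" for x
    using sum_squares_bound[of "cmod (h1 x)" "cmod (h2 x)"] by (simp add: norm_mult)
  have cm: "(\<lambda>x. cnj (h1 x)) \<in> borel_measurable lebesgue"
    using measurable_compose[OF m(1) borel_measurable_continuous_onI[OF continuous_on_cnj[OF continuous_on_id]]]
    by simp
  have mm: "(\<lambda>x. cnj (h1 x) * h2 x) \<in> borel_measurable lebesgue"
    using cm m(2) by (rule borel_measurable_times)
  show int: "integrable lebesgue (\<lambda>x. cnj (h1 x) * h2 x)"
    by (rule Bochner_Integration.integrable_bound[OF i2 mm]) (use le in \<open>auto simp: abs_of_nonneg\<close>)
  have "cmod (L2_inner h1 h2) \<le> (LINT x|lebesgue. cmod (cnj (h1 x) * h2 x))"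
    unfolding L2_inner_def by (rule integral_norm_bound)
  also have "\<dots> \<le> (LINT x|lebesgue. ((cmod (h1 x))\<^sup>2 + (cmod (h2 x))\<^sup>2) / 2)"
    by (rule integral_mono[OF integrable_norm[OF int] i2]) (rule le)
  also have "\<dots> = ((LINT x|lebesgue. (cmod (h1 x))\<^sup>2) + (LINT x|lebesgue. (cmod (h2 x))\<^sup>2)) / 2"
    using i by simp
  finally show "cmod (L2_inner h1 h2) \<le>
      ((LINT x|lebesgue. (cmod (h1 x))\<^sup>2) + (LINT x|lebesgue. (cmod (h2 x))\<^sup>2)) / 2" .
qed

lemma L2_lincomb:
  assumes "u \<in> L2" "v \<in> L2"
  shows "(\<lambda>x. a * u x + b * v x) \<in> L2"
proof -
  have m[measurable]: "u \<in> borel_measurable lebesgue" "v \<in> borel_measurable lebesgue"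
    and i: "integrable lebesgue (\<lambda>x. (cmod (u x))\<^sup>2)" "integrable lebesgue (\<lambda>x. (cmod (v x))\<^sup>2)"
    using assms by (auto simp: L2_def)
  have i2: "integrable lebesgue (\<lambda>x. 2 * (cmod a)\<^sup>2 * (cmod (u x))\<^sup>2 + 2 * (cmod b)\<^sup>2 * (cmod (v x))\<^sup>2)"
    using i by auto
  have le: "(cmod (a * u x + b * v x))\<^sup>2 \<le>
      2 * (cmod a)\<^sup>2 * (cmod (u x))\<^sup>2 + 2 * (cmod b)\<^sup>2 * (cmod (v x))\<^sup>2" for x
  proof -
    have "(cmod (a * u x + b * v x))\<^sup>2 \<le> (cmod (a * u x) + cmod (b * v x))\<^sup>2"
      by (intro power_mono norm_triangle_ineq) auto
    also have "\<dots> \<le> 2 * (cmod (a * u x))\<^sup>2 + 2 * (cmod (b * v x))\<^sup>2"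
      using sum_squares_bound[of "cmod (a * u x)" "cmod (b * v x)"]
      by (simp add: power2_sum)
    finally show ?thesis by (simp add: norm_mult power_mult_distrib)
  qed
  have "integrable lebesgue (\<lambda>x. (cmod (a * u x + b * v x))\<^sup>2)"
    by (rule Bochner_Integration.integrable_bound[OF i2])
       (use le in \<open>auto intro!: order_trans[OF _ abs_ge_self]\<close>)
  then show ?thesis by (auto simp: L2_def)
qed

lemma spaceV_lincomb:
  assumes "u \<in> spaceV \<rho>f \<rho>g" "v \<in> spaceV \<rho>f \<rho>g"
  shows "(\<lambda>x. a * u x + b * v x) \<in> spaceV \<rho>f \<rho>g"
proof -
  have "(\<lambda>x. (a * u x + b * v x) * \<rho> x) \<in> L2"
    if "(\<lambda>x. u x * \<rho> x) \<in> L2" "(\<lambda>x. v x * \<rho> x) \<in> L2" for \<rho> :: "real \<Rightarrow> complex"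
    using L2_lincomb[OF that, of a b] by (simp add: algebra_simps)
  then show ?thesis
    using assms L2_lincomb by (auto simp: spaceV_def)
qed

lemma tauV_tendsto_limit_in_spaceV:
  assumes "tauV_tendsto \<rho>f \<rho>g u v"
  shows "v \<in> spaceV \<rho>f \<rho>g"
  using assms by (auto simp: tauV_tendsto_def L2_tendsto_def spaceV_def mult.commute)

text \<open>Continuous linear functionals descend to classes modulo equality almost everywhere.\<close>

lemma dualV_AE_cong:
  assumes \<Lambda>: "\<Lambda> \<in> dualV \<rho>f \<rho>g" and uv: "u \<in> spaceV \<rho>f \<rho>g" "v \<in> spaceV \<rho>f \<rho>g"
    and ae: "AE x in lebesgue. u x = v x"
  shows "\<Lambda> u = \<Lambda> v"
proof -
  have 0: "L2_norm (\<lambda>x. r x * u x - r x * v x) = 0" for r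
  proof -
    have "(LINT x|lebesgue. (cmod (r x * u x - r x * v x))\<^sup>2) = 0"
      by (rule integral_eq_zero_AE) (use ae in auto)
    then show ?thesis by (simp add: L2_norm_def)
  qed
  have "tauV_tendsto \<rho>f \<rho>g (\<lambda>_. u) v"
    using uv 0[of "\<lambda>_. 1"] 0[of \<rho>f] 0[of \<rho>g]
    by (auto simp: tauV_tendsto_def L2_tendsto_def spaceV_def mult.commute)
  then have "(\<lambda>k::nat. \<Lambda> u) \<longlonglongrightarrow> \<Lambda> v"
    using \<Lambda> by (auto simp: dualV_def)
  then show ?thesis
    by (simp add: LIMSEQ_const_iff)
qed

lemma gen_fact_pos:
  assumes "strict_mono \<alpha>" "\<alpha> 0 = 0"
  shows "gen_fact \<alpha> n > 0"
  unfolding gen_fact_def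
proof (rule prod_pos)
  fix k assume "k \<in> {1..n}"
  then show "\<alpha> k > 0" using strict_monoD[OF assms(1), of 0 k] assms(2) by auto
qed

lemma summable_coh_weight:
  assumes \<alpha>: "strict_mono \<alpha>" "\<alpha> 0 = 0" and r: "0 \<le> r" "ereal r < (SUP n. ereal (\<alpha> n))"
  shows "summable (\<lambda>n. r ^ n / gen_fact \<alpha> n)"
proof -
  obtain m where m: "r < \<alpha> m"
    using r(2) by (auto simp: less_SUP_iff)
  have pos: "\<alpha> m > 0" using m r(1) by simp
  show ?thesis
  proof (rule summable_ratio_test[of "r / \<alpha> m" m])
    show "r / \<alpha> m < 1" using m pos by simp
    fix n assume "m \<le> n"
    then have "\<alpha> m \<le> \<alpha> (Suc n)"
      using \<alpha>(1) by (simp add: strict_mono_less_eq)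
    moreover have "gen_fact \<alpha> (Suc n) = gen_fact \<alpha> n * \<alpha> (Suc n)"
      by (simp add: gen_fact_def)
    moreover have "r ^ n / gen_fact \<alpha> n * (r / \<alpha> (Suc n)) \<le> r ^ n / gen_fact \<alpha> n * (r / \<alpha> m)"
      using calculation(1) pos r(1) gen_fact_pos[OF \<alpha>, of n]
      by (intro mult_left_mono divide_left_mono) auto
    ultimately show "norm (r ^ Suc n / gen_fact \<alpha> (Suc n)) \<le> r / \<alpha> m * norm (r ^ n / gen_fact \<alpha> n)"
      using r(1) pos gen_fact_pos[OF \<alpha>, of n] gen_fact_pos[OF \<alpha>, of "Suc n"]
      by (simp add: abs_of_nonneg mult_ac)
  qed
qed

lemma summable_coh_norm:
  assumes \<alpha>: "strict_mono \<alpha>" "\<alpha> 0 = 0" and r: "0 \<le> r" "ereal r < (SUP n. ereal (\<alpha> n))"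
  shows "summable (\<lambda>n. r ^ (2 * n) / (gen_fact \<alpha> n)\<^sup>2)"
proof (rule summable_comparison_test_ev[OF _ summable_coh_weight[OF assms]])
  have "(\<lambda>n. r ^ n / gen_fact \<alpha> n) \<longlonglongrightarrow> 0"
    using summable_coh_weight[OF assms] by (rule summable_LIMSEQ_zero)
  then have "\<forall>\<^sub>F n in sequentially. r ^ n / gen_fact \<alpha> n < 1"
    by (rule order_tendstoD) simp
  then show "\<forall>\<^sub>F n in sequentially.
      norm (r ^ (2 * n) / (gen_fact \<alpha> n)\<^sup>2) \<le> r ^ n / gen_fact \<alpha> n"
  proof eventually_elim
    case (elim n)
    let ?q = "r ^ n / gen_fact \<alpha> n"
    have "?q \<ge> 0" using r(1) gen_fact_pos[OF \<alpha>, of n] by simp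
    then have "?q * ?q \<le> ?q" using elim by (intro mult_left_le) auto
    moreover have "r ^ (2 * n) / (gen_fact \<alpha> n)\<^sup>2 = ?q * ?q"
      by (simp add: power_mult[symmetric] power2_eq_square power_add mult_2)
    ultimately show ?case using \<open>?q \<ge> 0\<close> by simp
  qed
qed

text \<open>
  The pairings and the series defining the coherent functionals converge; the lemma applies with
  \<open>\<rho> = \<rho>f\<close> and with \<open>\<rho> = \<rho>g\<close>.
\<close>

lemma coh_series_converges:
  assumes c: "L2_orthonormal_basis c"
    and \<alpha>: "strict_mono \<alpha>" "\<alpha> 0 = 0" and z: "ereal (cmod z) < (SUP n. ereal (\<alpha> n))"
    and \<rho>: "\<rho> \<in> borel_measurable lebesgue"
    and v: "v \<in> L2" "(\<lambda>x. v x * \<rho> x) \<in> L2"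
  shows "integrable lebesgue (\<lambda>x. cnj (c n x * \<rho> x) * v x)"
    and "summable (\<lambda>n. cnj z ^ n / complex_of_real (gen_fact \<alpha> n) * L2_inner (\<lambda>x. c n x * \<rho> x) v)"
proof -
  define w where "w = (\<lambda>x. cnj (\<rho> x) * v x)"
  have "(\<lambda>x. cnj (\<rho> x)) \<in> borel_measurable lebesgue"
    using measurable_compose[OF \<rho> borel_measurable_continuous_onI[OF continuous_on_cnj[OF continuous_on_id]]]
    by simp
  then have w: "w \<in> L2"
    using v by (auto simp: L2_def w_def norm_mult power_mult_distrib mult.commute)
  have cL: "c n \<in> L2" for n using c by (simp add: L2_orthonormal_basis_def)
  have eq: "(\<lambda>x. cnj (c n x * \<rho> x) * v x) = (\<lambda>x. cnj (c n x) * w x)" for n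
    by (simp add: w_def mult.assoc)
  then show "integrable lebesgue (\<lambda>x. cnj (c n x * \<rho> x) * v x)"
    using L2_mult_integrable(1)[OF cL w] by simp
  have c1: "(LINT x|lebesgue. (cmod (c n x))\<^sup>2) = 1" for n
  proof -
    have "complex_of_real (LINT x|lebesgue. (cmod (c n x))\<^sup>2) = L2_inner (c n) (c n)"
      unfolding L2_inner_def integral_complex_of_real[symmetric]
      by (intro Bochner_Integration.integral_cong) (simp_all only: complex_norm_square mult.commute)
    also have "\<dots> = 1" using c by (simp add: L2_orthonormal_basis_def)
    finally show ?thesis using of_real_eq_1_iff by blast
  qed
  define B where "B = (1 + (LINT x|lebesgue. (cmod (w x))\<^sup>2)) / 2"
  have B: "cmod (L2_inner (\<lambda>x. c n x * \<rho> x) v) \<le> B" for n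
    using L2_mult_integrable(2)[OF cL w, of n] c1[of n] eq[of n]
    by (simp add: B_def L2_inner_def)
  have "summable (\<lambda>n. cmod z ^ n / gen_fact \<alpha> n * B)"
    by (intro summable_mult2 summable_coh_weight \<alpha> z) auto
  then show "summable (\<lambda>n. cnj z ^ n / complex_of_real (gen_fact \<alpha> n) * L2_inner (\<lambda>x. c n x * \<rho> x) v)"
  proof (rule summable_comparison_test[rotated], intro exI[of _ 0] allI impI)
    fix n
    show "norm (cnj z ^ n / complex_of_real (gen_fact \<alpha> n) * L2_inner (\<lambda>x. c n x * \<rho> x) v)
        \<le> cmod z ^ n / gen_fact \<alpha> n * B"
      using B[of n] gen_fact_pos[OF \<alpha>, of n]
      by (auto simp: norm_mult norm_divide norm_power intro!: mult_mono divide_right_mono)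
  qed
qed

end

theory Submission
  imports Defs
begin

text \<open>
  Moving the weight across the pairing gives \<open>\<langle>c\<^sub>n \<rho>, v\<rangle> = \<langle>c\<^sub>n, cnj \<rho> v\<rangle>\<close>, which Cauchy--Schwarz bounds by
  \<open>\<parallel>\<rho> v\<parallel>\<close> uniformly in \<open>n\<close>. The weights \<open>|z|\<^sup>n / \<alpha>\<^sub>n!\<close> being summable, each functional is bounded by
  a constant times \<open>\<parallel>\<rho> v\<parallel>\<close>, and the latter is controlled by the topology of the space.
\<close>

lemma L2_norm_power2: "(L2_norm h)\<^sup>2 = (LINT x|lebesgue. (cmod (h x))\<^sup>2)"
  by (simp add: L2_norm_def)

lemma L2_norm_nonneg: "0 \<le> L2_norm h"
  by (simp add: L2_norm_def)

text \<open>The additive bound in \<open>L2_mult_integrable\<close> is enough for convergence of the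
  series, but it does not tend to zero with \<open>h2\<close>. Continuity needs this product form,
  obtained from the inequality for nonnegative integrals.\<close>

lemma L2_Cauchy_Schwarz:
  assumes h: "h1 \<in> L2" "h2 \<in> L2"
  shows "cmod (L2_inner h1 h2) \<le> L2_norm h1 * L2_norm h2"
proof -
  have m: "h1 \<in> borel_measurable lebesgue" "h2 \<in> borel_measurable lebesgue"
    and i: "integrable lebesgue (\<lambda>x. (cmod (h1 x))\<^sup>2)" "integrable lebesgue (\<lambda>x. (cmod (h2 x))\<^sup>2)"
    using h by (auto simp: L2_def)
  \<comment> \<open>Membership in \<open>L2\<close> makes the extended integral finite, so the final
    estimate can be read back in the reals.\<close>
  have n: "(\<integral>\<^sup>+x. (ennreal (cmod (h x)))\<^sup>2 \<partial>lebesgue) = ennreal ((L2_norm h)\<^sup>2)" if "h \<in> L2" for h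
    using that by (simp add: L2_norm_power2 L2_def ennreal_power nn_integral_eq_integral)
  have "ennreal (cmod (L2_inner h1 h2)) \<le> (\<integral>\<^sup>+x. ennreal (cmod (h1 x)) * ennreal (cmod (h2 x)) \<partial>lebesgue)"
    using integral_norm_bound_ennreal[OF L2_mult_integrable(1)[OF h]]
    by (simp add: L2_inner_def norm_mult ennreal_mult)
  then have "(ennreal (cmod (L2_inner h1 h2)))\<^sup>2 \<le>
      (\<integral>\<^sup>+x. ennreal (cmod (h1 x)) * ennreal (cmod (h2 x)) \<partial>lebesgue)\<^sup>2"
    by (intro power_mono) auto
  also have "\<dots> \<le> ennreal ((L2_norm h1)\<^sup>2) * ennreal ((L2_norm h2)\<^sup>2)"
    unfolding n[OF h(1), symmetric] n[OF h(2), symmetric]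
    using m by (intro Cauchy_Schwarz_nn_integral) auto
  also have "\<dots> = ennreal ((L2_norm h1 * L2_norm h2)\<^sup>2)"
    by (simp add: ennreal_mult power_mult_distrib)
  finally have "(cmod (L2_inner h1 h2))\<^sup>2 \<le> (L2_norm h1 * L2_norm h2)\<^sup>2"
    by (simp add: ennreal_power)
  then show ?thesis
    by (rule power2_le_imp_le) (simp add: L2_norm_nonneg)
qed

lemma L2_orthonormal_basis_norm:
  assumes "L2_orthonormal_basis c"
  shows "L2_norm (c n) = 1"
proof -
  have "complex_of_real ((L2_norm (c n))\<^sup>2) = L2_inner (c n) (c n)"
    unfolding L2_norm_power2 L2_inner_def integral_complex_of_real[symmetric]
    by (intro Bochner_Integration.integral_cong) (simp_all only: complex_norm_square mult.commute)
  also have "\<dots> = 1" using assms by (simp add: L2_orthonormal_basis_def)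
  finally have "(L2_norm (c n))\<^sup>2 = 1" using of_real_eq_1_iff by blast
  \<comment> \<open>Nonnegativity excludes the root -1.\<close>
  then show ?thesis using L2_norm_nonneg[of "c n"] by (simp add: power2_eq_1_iff)
qed

text \<open>The bound is uniform in \<open>n\<close> because the \<open>c n\<close> are unit vectors
  and conjugating \<rho> does not change the modulus of the product with \<open>v\<close>.\<close>

lemma weighted_inner_bound:
  assumes c: "L2_orthonormal_basis c" and \<rho>: "\<rho> \<in> borel_measurable lebesgue"
    and v: "v \<in> L2" "(\<lambda>x. v x * \<rho> x) \<in> L2"
  shows "cmod (L2_inner (\<lambda>x. c n x * \<rho> x) v) \<le> L2_norm (\<lambda>x. v x * \<rho> x)"
proof -
  \<comment> \<open>The product of \<open>c n\<close> and \<rho> may fall outside \<open>L2\<close>,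
    so Cauchy-Schwarz is applied only after \<rho> has been moved onto \<open>v\<close>.\<close>
  define w where "w = (\<lambda>x. cnj (\<rho> x) * v x)"
  have "(\<lambda>x. cnj (\<rho> x)) \<in> borel_measurable lebesgue"
    using measurable_compose[OF \<rho> borel_measurable_continuous_onI[OF continuous_on_cnj[OF continuous_on_id]]]
    by simp
  then have w: "w \<in> L2"
    using v by (auto simp: L2_def w_def norm_mult power_mult_distrib mult.commute)
  have cn: "c n \<in> L2" using c by (simp add: L2_orthonormal_basis_def)
  have "L2_inner (\<lambda>x. c n x * \<rho> x) v = L2_inner (c n) w"
    by (simp add: L2_inner_def w_def mult.assoc)
  moreover have "L2_norm w = L2_norm (\<lambda>x. v x * \<rho> x)"
    by (simp add: L2_norm_def w_def norm_mult mult.commute)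
  ultimately show ?thesis
    using L2_Cauchy_Schwarz[OF cn w] L2_orthonormal_basis_norm[OF c, of n] by simp
qed

text \<open>Splitting the integral and then the series is legitimate because
  \<open>coh_series_converges\<close> gives convergence of both for \<open>u\<close> and for
  \<open>v\<close> separately.\<close>

lemma coh_functional_linear:
  assumes c: "L2_orthonormal_basis c"
    and \<alpha>: "strict_mono \<alpha>" "\<alpha> 0 = 0" and z: "ereal (cmod z) < (SUP n. ereal (\<alpha> n))"
    and \<rho>: "\<rho> \<in> borel_measurable lebesgue"
    and u: "u \<in> L2" "(\<lambda>x. u x * \<rho> x) \<in> L2"
    and v: "v \<in> L2" "(\<lambda>x. v x * \<rho> x) \<in> L2"
  shows "coh_functional \<alpha> (\<lambda>n x. c n x * \<rho> x) z (\<lambda>x. a * u x + b * v x) =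
    a * coh_functional \<alpha> (\<lambda>n x. c n x * \<rho> x) z u + b * coh_functional \<alpha> (\<lambda>n x. c n x * \<rho> x) z v"
proof -
  note cu = coh_series_converges[OF c \<alpha> z \<rho> u] and cv = coh_series_converges[OF c \<alpha> z \<rho> v]
  define W where "W n = cnj z ^ n / complex_of_real (gen_fact \<alpha> n)" for n
  have "L2_inner (\<lambda>x. c n x * \<rho> x) (\<lambda>x. a * u x + b * v x) =
      a * L2_inner (\<lambda>x. c n x * \<rho> x) u + b * L2_inner (\<lambda>x. c n x * \<rho> x) v" for n
  proof -
    have "L2_inner (\<lambda>x. c n x * \<rho> x) (\<lambda>x. a * u x + b * v x) =
        (LINT x|lebesgue. a * (cnj (c n x * \<rho> x) * u x) + b * (cnj (c n x * \<rho> x) * v x))"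
      unfolding L2_inner_def by (rule Bochner_Integration.integral_cong) (simp_all add: algebra_simps)
    also have "\<dots> = a * L2_inner (\<lambda>x. c n x * \<rho> x) u + b * L2_inner (\<lambda>x. c n x * \<rho> x) v"
      unfolding L2_inner_def using cu(1)[of n] cv(1)[of n]
      by (subst Bochner_Integration.integral_add)
         (simp_all only: integrable_mult_right integral_mult_right_zero simp_thms)
    finally show ?thesis .
  qed
  then have "(\<lambda>n. W n * L2_inner (\<lambda>x. c n x * \<rho> x) (\<lambda>x. a * u x + b * v x)) =
      (\<lambda>n. a * (W n * L2_inner (\<lambda>x. c n x * \<rho> x) u) + b * (W n * L2_inner (\<lambda>x. c n x * \<rho> x) v))"
    by (simp add: algebra_simps)
  moreover have "(\<lambda>n. a * (W n * L2_inner (\<lambda>x. c n x * \<rho> x) u) + b * (W n * L2_inner (\<lambda>x. c n x * \<rho> x) v))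
      sums (a * (\<Sum>n. W n * L2_inner (\<lambda>x. c n x * \<rho> x) u) + b * (\<Sum>n. W n * L2_inner (\<lambda>x. c n x * \<rho> x) v))"
    using cu(2) cv(2) unfolding W_def by (intro sums_add sums_mult summable_sums)
  ultimately show ?thesis
    by (simp add: coh_functional_def W_def[symmetric] sums_iff algebra_simps)
qed

text \<open>Termwise, the uniform bound on the pairings leaves the summable weights, so the constant
  in front of the weighted norm depends on \<alpha> and \<open>z\<close> but not on
  \<open>v\<close>.\<close>

lemma coh_functional_bound:
  assumes c: "L2_orthonormal_basis c"
    and \<alpha>: "strict_mono \<alpha>" "\<alpha> 0 = 0" and z: "ereal (cmod z) < (SUP n. ereal (\<alpha> n))"
    and \<rho>: "\<rho> \<in> borel_measurable lebesgue"
    and v: "v \<in> L2" "(\<lambda>x. v x * \<rho> x) \<in> L2"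
  shows "cmod (coh_functional \<alpha> (\<lambda>n x. c n x * \<rho> x) z v) \<le>
    coh_norm \<alpha> (cmod z) * (\<Sum>n. cmod z ^ n / gen_fact \<alpha> n) * L2_norm (\<lambda>x. v x * \<rho> x)"
proof -
  let ?M = "L2_norm (\<lambda>x. v x * \<rho> x)"
  have s: "summable (\<lambda>n. cmod z ^ n / gen_fact \<alpha> n)"
    using \<alpha> z by (intro summable_coh_weight) auto
  have "cmod (\<Sum>n. cnj z ^ n / complex_of_real (gen_fact \<alpha> n) * L2_inner (\<lambda>x. c n x * \<rho> x) v)
      \<le> (\<Sum>n. cmod z ^ n / gen_fact \<alpha> n * ?M)"
  proof (rule norm_suminf_le[OF _ summable_mult2[OF s]])
    show "cmod (cnj z ^ n / complex_of_real (gen_fact \<alpha> n) * L2_inner (\<lambda>x. c n x * \<rho> x) v)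
        \<le> cmod z ^ n / gen_fact \<alpha> n * ?M" for n
      using weighted_inner_bound[OF c \<rho> v, of n] gen_fact_pos[OF \<alpha>, of n]
      by (auto simp: norm_mult norm_divide norm_power intro!: mult_mono divide_right_mono)
  qed
  also have "\<dots> = (\<Sum>n. cmod z ^ n / gen_fact \<alpha> n) * ?M"
    using suminf_mult2[OF s] by simp
  \<comment> \<open>As a real power, \<open>coh_norm\<close> is nonnegative, so it equals its own
    modulus and multiplication by it preserves the inequality.\<close>
  finally show ?thesis
    by (simp add: coh_functional_def norm_mult coh_norm_def mult.assoc mult_left_mono)
qed

text \<open>Linearity reduces the difference of values to the value at \<open>u k - v\<close>, which
  the bound controls by a weighted norm tending to zero.\<close>

lemma coh_functional_tendsto:
  assumes c: "L2_orthonormal_basis c"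
    and \<alpha>: "strict_mono \<alpha>" "\<alpha> 0 = 0" and z: "ereal (cmod z) < (SUP n. ereal (\<alpha> n))"
    and \<rho>: "\<rho> \<in> borel_measurable lebesgue"
    and u: "\<And>k. u k \<in> L2" and v: "v \<in> L2"
    and lim: "L2_tendsto (\<lambda>k x. \<rho> x * u k x) (\<lambda>x. \<rho> x * v x)"
  shows "(\<lambda>k. coh_functional \<alpha> (\<lambda>n x. c n x * \<rho> x) z (u k)) \<longlonglongrightarrow>
    coh_functional \<alpha> (\<lambda>n x. c n x * \<rho> x) z v"
proof -
  let ?\<Lambda> = "coh_functional \<alpha> (\<lambda>n x. c n x * \<rho> x) z"
  let ?K = "coh_norm \<alpha> (cmod z) * (\<Sum>n. cmod z ^ n / gen_fact \<alpha> n)"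
  have u': "(\<lambda>x. u k x * \<rho> x) \<in> L2" for k
    using lim by (simp add: L2_tendsto_def mult.commute)
  have v': "(\<lambda>x. v x * \<rho> x) \<in> L2"
    using lim by (simp add: L2_tendsto_def mult.commute)
  have "cmod (?\<Lambda> (u k) - ?\<Lambda> v) \<le> ?K * L2_norm (\<lambda>x. \<rho> x * u k x - \<rho> x * v x)" for k
  proof -
    \<comment> \<open>The difference must satisfy both membership hypotheses of the bound; it is the
      linear combination with coefficients 1 and -1.\<close>
    have d: "(\<lambda>x. u k x - v x) \<in> L2" "(\<lambda>x. (u k x - v x) * \<rho> x) \<in> L2"
      using L2_lincomb[OF u v, of 1 k "-1"] L2_lincomb[OF u' v', of 1 k "-1"]
      by (simp_all add: left_diff_distrib)
    have "?\<Lambda> (u k) - ?\<Lambda> v = ?\<Lambda> (\<lambda>x. u k x - v x)"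
      using coh_functional_linear[OF c \<alpha> z \<rho> u u' v v', of 1 k "-1"] by simp
    then show ?thesis
      using coh_functional_bound[OF c \<alpha> z \<rho> d] by (simp add: algebra_simps)
  qed
  then have "\<forall>\<^sub>F k in sequentially.
      cmod (?\<Lambda> (u k) - ?\<Lambda> v) \<le> ?K * L2_norm (\<lambda>x. \<rho> x * u k x - \<rho> x * v x)"
    by (intro always_eventually allI)
  \<comment> \<open>The factor \<open>?K\<close> does not vary with \<open>k\<close>.\<close>
  moreover have "(\<lambda>k. ?K * L2_norm (\<lambda>x. \<rho> x * u k x - \<rho> x * v x)) \<longlonglongrightarrow> 0"
    using lim by (intro tendsto_mult_right_zero) (simp add: L2_tendsto_def)
  ultimately have "(\<lambda>k. ?\<Lambda> (u k) - ?\<Lambda> v) \<longlonglongrightarrow> 0"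
    by (rule Lim_null_comparison)
  then show ?thesis
    by (rule LIM_zero_cancel)
qed

theorem proposition8:
  fixes c :: "nat \<Rightarrow> real \<Rightarrow> complex"
    and \<rho>f \<rho>g :: "real \<Rightarrow> complex"
    and \<alpha> :: "nat \<Rightarrow> real"
  assumes "L2_orthonormal_basis c"
    and "\<rho>f \<in> borel_measurable lebesgue" and "\<rho>g \<in> borel_measurable lebesgue"
    and "AE x in lebesgue. \<rho>f x \<noteq> 0" and "AE x in lebesgue. \<rho>g x \<noteq> 0"
    and "AE x in lebesgue. \<rho>f x = inverse (cnj (\<rho>g x))"
    and "strict_mono \<alpha>" and "\<alpha> 0 = 0"
  shows "\<forall>z::complex. ereal (cmod z) < (SUP n. ereal (\<alpha> n)) \<longrightarrow>
           coh_F \<alpha> c \<rho>f z \<in> dualV \<rho>f \<rho>g \<and> coh_G \<alpha> c \<rho>g z \<in> dualV \<rho>f \<rho>g"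
proof (intro allI impI)
  fix z :: complex
  assume z: "ereal (cmod z) < (SUP n. ereal (\<alpha> n))"
  \<comment> \<open>The definitions of \<open>spaceV\<close> and \<open>tauV_tendsto\<close> treat
    the two weights alike, so one argument serves both functionals.\<close>
  have "coh_functional \<alpha> (\<lambda>n x. c n x * \<rho> x) z \<in> dualV \<rho>f \<rho>g" if "\<rho> = \<rho>f \<or> \<rho> = \<rho>g" for \<rho>
  proof -
    have \<rho>: "\<rho> \<in> borel_measurable lebesgue"
      using that assms(2,3) by auto
    have V: "v \<in> L2" "(\<lambda>x. v x * \<rho> x) \<in> L2" if "v \<in> spaceV \<rho>f \<rho>g" for v
      using that \<open>\<rho> = \<rho>f \<or> \<rho> = \<rho>g\<close> by (auto simp: spaceV_def)
    have "linear_on_V \<rho>f \<rho>g (coh_functional \<alpha> (\<lambda>n x. c n x * \<rho> x) z)"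
      unfolding linear_on_V_def
      using coh_functional_linear[OF assms(1,7,8) z \<rho>] V by blast
    moreover have "(\<lambda>k. coh_functional \<alpha> (\<lambda>n x. c n x * \<rho> x) z (u k)) \<longlonglongrightarrow>
        coh_functional \<alpha> (\<lambda>n x. c n x * \<rho> x) z v" if "tauV_tendsto \<rho>f \<rho>g u v" for u v
    proof (rule coh_functional_tendsto[OF assms(1,7,8) z \<rho>])
      show "u k \<in> L2" for k using that V by (simp add: tauV_tendsto_def)
      show "v \<in> L2" using that by (intro V(1) tauV_tendsto_limit_in_spaceV)
      \<comment> \<open>This is the component of the convergence in \<open>tauV_tendsto\<close> that
        belongs to the chosen weight.\<close>
      show "L2_tendsto (\<lambda>k x. \<rho> x * u k x) (\<lambda>x. \<rho> x * v x)"
        using that \<open>\<rho> = \<rho>f \<or> \<rho> = \<rho>g\<close> by (auto simp: tauV_tendsto_def)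
    qed
    ultimately show ?thesis by (simp add: dualV_def)
  qed
  then show "coh_F \<alpha> c \<rho>f z \<in> dualV \<rho>f \<rho>g \<and> coh_G \<alpha> c \<rho>g z \<in> dualV \<rho>f \<rho>g"
    by (simp add: coh_F_def coh_G_def)
qed

end
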